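(* Consider the heterogeneous discrete Bass model with $M$ nodes, external rates $p_j$ and internal rates $q_{i,j}$. For $\{m_1,\dots,m_n\}\subset\{1,\dots,M\}$ with distinct $m_i$ and $1\le n\le M$, let $[S^{m_1},\dots,S^{m_n}](t)$ be the probability that nodes $m_1,\dots,m_n$ are all nonadopters at time $t$. Then for every nonempty $\{m_1,\dots,m_n\}\subsetneq\{1,\dots,M\}$, with $\{l_{n+1},\dots,l_M\}=\{1,\dots,M\}\setminus\{m_1,\dots,m_n\}$, $$\frac{d}{dt}[S^{m_1},\dots,S^{m_n}](t)=-\Big(\sum_{i=1}^n p_{m_i}+\sum_{j=n+1}^M\sum_{i=1}^n q_{l_j,m_i}\Big)[S^{m_1},\dots,S^{m_n}](t)+\sum_{j=n+1}^M\Big(\sum_{i=1}^n q_{l_j,m_i}\Big)[S^{m_1},\dots,S^{m_n},S^{l_j}](t),$$ and $$\frac{d}{dt}[S^1,S^2,\dots,S^M](t)=-\Big(\sum_{i=1}^M p_i\Big)[S^1,S^2,\dots,S^M](t),$$ with initial conditions $[S^{m_1},\dots,S^{m_n}](0)=1$ for all nonempty $\{m_1,\dots,m_n\}\subset\{1,\dots,M\}$.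
   Context: Heterogeneous discrete Bass model: a network has $M$ nodes, external rates $p_j\ge 0$ and internal rates $q_{i,j}\ge 0$ ($i\ne j$; the influence of $i$ on $j$). $X_j(t)\in\{0,1\}$ is the state of node $j$ ($1$ = adopter, $0$ = nonadopter), $X_j(0)=0$ for all $j$. The process $(X_1,\dots,X_M)$ is a continuous-time Markov chain in which adopters remain adopters forever, and each nonadopter $j$ becomes an adopter at rate $p_j+\sum_{k\ne j}q_{k,j}X_k(t)$ (one node changes at a time). *)

theory Defs
  imports "HOL-Probability.Probability"
begin

definition transition_semigroup :: "(real \<Rightarrow> 's::finite \<Rightarrow> 's \<Rightarrow> real) \<Rightarrow> bool" where
  "transition_semigroup P \<longleftrightarrow>
     (\<forall>t\<ge>0. \<forall>x y. 0 \<le> P t x y) \<and>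
     (\<forall>t\<ge>0. \<forall>x. (\<Sum>y\<in>UNIV. P t x y) = 1) \<and>
     (\<forall>x y. P 0 x y = of_bool (x = y)) \<and>
     (\<forall>s\<ge>0. \<forall>t\<ge>0. \<forall>x y. P (s + t) x y = (\<Sum>z\<in>UNIV. P s x z * P t z y))"

text \<open>
  The entry \<open>Q x y\<close> is the rate of jumping from \<open>x\<close> to \<open>y\<close> when \<open>x \<noteq> y\<close>: the condition says
  \<open>P h x y = of_bool (x = y) + Q x y * h + o(h)\<close> as \<open>h\<close> tends to 0 from the right.
\<close>

definition has_generator ::
    "(real \<Rightarrow> 's::finite \<Rightarrow> 's \<Rightarrow> real) \<Rightarrow> ('s \<Rightarrow> 's \<Rightarrow> real) \<Rightarrow> bool" where
  "has_generator P Q \<longleftrightarrow>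
     (\<forall>x y. ((\<lambda>h. P h x y) has_real_derivative Q x y) (at 0 within {0..}))"

text \<open>
  Only the restriction of \<open>Y\<close> to times \<open>t \<ge> 0\<close> matters, and no regularity of the sample paths is
  required. The displayed identity combines the Markov property with time-homogeneity.
\<close>

definition ctmc ::
    "'w measure \<Rightarrow> ('s::finite \<Rightarrow> 's \<Rightarrow> real) \<Rightarrow> (real \<Rightarrow> 'w \<Rightarrow> 's) \<Rightarrow> bool" where
  "ctmc \<Omega> Q Y \<longleftrightarrow>
     prob_space \<Omega> \<and>
     (\<forall>t\<ge>0. Y t \<in> measurable \<Omega> (count_space UNIV)) \<and>
     (\<exists>P. transition_semigroup P \<and> has_generator P Q \<and>
        (\<forall>(n::nat) \<tau> x u y.
           0 \<le> \<tau> 0 \<and> (\<forall>i<n. \<tau> i < \<tau> (Suc i)) \<and> \<tau> n \<le> u \<and>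
           \<P>(\<omega> in \<Omega>. \<forall>i\<le>n. Y (\<tau> i) \<omega> = x i) > 0 \<longrightarrow>
           \<P>(\<omega> in \<Omega>. Y u \<omega> = y \<bar> \<forall>i\<le>n. Y (\<tau> i) \<omega> = x i) = P (u - \<tau> n) (x n) y))"

text \<open>
  The nodes are the elements of a finite type \<open>'n\<close>, so their number is \<open>CARD('n)\<close>. A state of the
  network is a function \<open>x :: 'n \<Rightarrow> bool\<close>, where \<open>x j\<close> says that \<open>j\<close> is an adopter (state 1).
  The diagonal entries of \<open>q\<close> carry no meaning and are never used.
\<close>

definition adoption_rate ::
    "('n::finite \<Rightarrow> real) \<Rightarrow> ('n \<Rightarrow> 'n \<Rightarrow> real) \<Rightarrow> ('n \<Rightarrow> bool) \<Rightarrow> 'n \<Rightarrow> real" where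
  "adoption_rate p q x j = p j + (\<Sum>k\<in>UNIV - {j}. q k j * of_bool (x k))"

text \<open>
  Off the diagonal the sum has at most one term: it is \<open>adoption_rate p q x j\<close> if \<open>y\<close> arises from
  \<open>x\<close> by the single nonadopter \<open>j\<close> adopting, and 0 otherwise. The diagonal makes the rows sum to 0.
\<close>

definition bass_generator ::
    "('n::finite \<Rightarrow> real) \<Rightarrow> ('n \<Rightarrow> 'n \<Rightarrow> real) \<Rightarrow> ('n \<Rightarrow> bool) \<Rightarrow> ('n \<Rightarrow> bool) \<Rightarrow> real" where
  "bass_generator p q x y =
     (if y = x then - (\<Sum>j | \<not> x j. adoption_rate p q x j)
      else (\<Sum>j | \<not> x j \<and> y = x(j := True). adoption_rate p q x j))"

definition bass_model ::
    "'w measure \<Rightarrow> ('n::finite \<Rightarrow> real) \<Rightarrow> ('n \<Rightarrow> 'n \<Rightarrow> real) \<Rightarrow> ('n \<Rightarrow> real \<Rightarrow> 'w \<Rightarrow> bool) \<Rightarrow> bool" where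
  "bass_model \<Omega> p q X \<longleftrightarrow>
     (\<forall>j. 0 \<le> p j) \<and>
     (\<forall>i j. i \<noteq> j \<longrightarrow> 0 \<le> q i j) \<and>
     ctmc \<Omega> (bass_generator p q) (\<lambda>t \<omega> j. X j t \<omega>) \<and>
     (AE \<omega> in \<Omega>. \<forall>j. \<not> X j 0 \<omega>) \<and>
     (AE \<omega> in \<Omega>. \<forall>j s t. 0 \<le> s \<and> s \<le> t \<and> X j s \<omega> \<longrightarrow> X j t \<omega>)"

definition nonadopter_prob ::
    "'w measure \<Rightarrow> ('n::finite \<Rightarrow> real \<Rightarrow> 'w \<Rightarrow> bool) \<Rightarrow> 'n set \<Rightarrow> real \<Rightarrow> real" where
  "nonadopter_prob \<Omega> X A t = \<P>(\<omega> in \<Omega>. \<forall>m\<in>A. \<not> X m t \<omega>)"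

end

theory Submission imports Defs begin

text \<open>
  Over a finite state space the transition semigroup satisfies Kolmogorov's forward equation
  \<open>P' = P Q\<close>. Both one-sided difference quotients are covered at once by writing
  \<open>(P s - P t) / (s - t) = P (min s t) ((P \<bar>s - t\<bar> - I) / \<bar>s - t\<bar>)\<close>. The quantity
  \<open>[S\<^sup>A](t)\<close> is the expectation of the indicator that all nodes of \<open>A\<close> are nonadopters, so it remains
  to apply the generator to this indicator: only the adoption of a node of \<open>A\<close> changes its value,
  and within \<open>A\<close> there are no adopters to exert any influence.
\<close>

lemma transition_semigroup_le_1:
  assumes "transition_semigroup P" "0 \<le> t"
  shows "P t x y \<le> 1"
proof -
  have "P t x y \<le> (\<Sum>z\<in>UNIV. P t x z)"
    by (rule member_le_sum) (use assms in \<open>auto simp: transition_semigroup_def\<close>)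
  then show ?thesis
    using assms by (auto simp: transition_semigroup_def)
qed

text \<open>Writing \<open>P s\<close> as \<open>P (s + 0)\<close> and applying the semigroup law to
  both terms keeps \<open>P 0\<close> in place of the identity matrix, so that dividing by
  \<open>t\<close> produces the difference quotient at 0 that defines the generator.\<close>

lemma transition_semigroup_diff:
  assumes "transition_semigroup P" "0 \<le> s" "0 \<le> t"
  shows "P (s + t) x y - P s x y = (\<Sum>z\<in>UNIV. P s x z * (P t z y - P 0 z y))"
proof -
  have "P s x y = P (s + 0) x y" by simp
  also have "\<dots> = (\<Sum>z\<in>UNIV. P s x z * P 0 z y)"
    using assms unfolding transition_semigroup_def by blast
  finally show ?thesis
    using assms by (simp add: transition_semigroup_def right_diff_distrib sum_subtractf)
qed

text \<open>Carries limits at 0 from the right over to limits at \<open>t\<close> from either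
  side.\<close>

lemma filterlim_abs_diff_at_0:
  fixes t :: real
  shows "filterlim (\<lambda>s. \<bar>s - t\<bar>) (at 0 within {0..}) (at t within S)"
  unfolding filterlim_at
  by (auto intro!: tendsto_eq_intros simp: eventually_at_filter)

text \<open>In the forward equation the left factor \<open>P (min s t)\<close> moves with
  \<open>s\<close> when \<open>s\<close> lies below \<open>t\<close>. Since entries of
  \<open>P s\<close> lie between 0 and 1, its increment up to \<open>t\<close> is bounded by a
  column norm of \<open>P h - P 0\<close> with \<open>h = t - s\<close>, which vanishes because
  differentiability at 0 implies continuity there.\<close>

lemma transition_semigroup_continuous:
  assumes P: "transition_semigroup P" and Q: "has_generator P Q" and t: "0 \<le> t"
  shows "((\<lambda>s. P (min s t) x y) \<longlongrightarrow> P t x y) (at t within {0..})"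
proof -
  define g where "g h = (\<Sum>z\<in>UNIV. \<bar>P h z y - P 0 z y\<bar>)" for h
  have "((\<lambda>h. P h z y) \<longlongrightarrow> P 0 z y) (at 0 within {0..})" for z
    using Q DERIV_continuous unfolding has_generator_def continuous_within by blast
  then have "(g \<longlongrightarrow> 0) (at 0 within {0..})"
    unfolding g_def by (auto intro!: tendsto_eq_intros)
  then have g: "((\<lambda>s. g \<bar>s - t\<bar>) \<longlongrightarrow> 0) (at t within {0..})"
    by (rule filterlim_compose[OF _ filterlim_abs_diff_at_0])
  have bound: "\<bar>P (min s t) x y - P t x y\<bar> \<le> g \<bar>s - t\<bar>" if s: "0 \<le> s" for s
  proof (cases "s \<le> t")
    case True
    have "P t x y - P s x y = (\<Sum>z\<in>UNIV. P s x z * (P \<bar>s - t\<bar> z y - P 0 z y))"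
      using transition_semigroup_diff[OF P s, of "t - s" x y] True by simp
    also have "\<bar>\<dots>\<bar> \<le> g \<bar>s - t\<bar>"
      unfolding g_def
    proof (rule order_trans[OF sum_abs sum_mono])
      fix z
      have "\<bar>P s x z\<bar> \<le> 1"
        using transition_semigroup_le_1[OF P s, of x z] P s by (auto simp: transition_semigroup_def)
      then show "\<bar>P s x z * (P \<bar>s - t\<bar> z y - P 0 z y)\<bar> \<le> \<bar>P \<bar>s - t\<bar> z y - P 0 z y\<bar>"
        by (simp add: abs_mult mult_left_le_one_le)
    qed
    finally show ?thesis using True by (simp add: min_def abs_minus_commute)
  next
    case False
    then show ?thesis by (simp add: g_def sum_nonneg)
  qed
  have "((\<lambda>s. P (min s t) x y - P t x y) \<longlongrightarrow> 0) (at t within {0..})"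
    by (rule Lim_null_comparison[OF _ g]) (use bound in \<open>auto simp: eventually_at_filter\<close>)
  then show ?thesis by (simp add: LIM_zero_iff)
qed

proposition kolmogorov_forward:
  assumes P: "transition_semigroup P" and Q: "has_generator P Q" and t: "0 \<le> t"
  shows "((\<lambda>s. P s x y) has_real_derivative (\<Sum>z\<in>UNIV. P t x z * Q z y)) (at t within {0..})"
  unfolding has_field_derivative_iff
proof (rule Lim_transform_eventually)
  have "((\<lambda>h. (P h z y - P 0 z y) / h) \<longlongrightarrow> Q z y) (at 0 within {0..})" for z
    using Q by (simp add: has_generator_def has_field_derivative_iff)
  then have "((\<lambda>s. (P \<bar>s - t\<bar> z y - P 0 z y) / \<bar>s - t\<bar>) \<longlongrightarrow> Q z y) (at t within {0..})" for z
    by (rule filterlim_compose[OF _ filterlim_abs_diff_at_0])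
  then show "((\<lambda>s. \<Sum>z\<in>UNIV. P (min s t) x z * ((P \<bar>s - t\<bar> z y - P 0 z y) / \<bar>s - t\<bar>))
      \<longlongrightarrow> (\<Sum>z\<in>UNIV. P t x z * Q z y)) (at t within {0..})"
    by (intro tendsto_sum tendsto_mult transition_semigroup_continuous[OF P Q t])
  \<comment> \<open>As \<open>min s t + |s - t|\<close> is the larger of the two times, the sum is a
    difference quotient between the smaller and the larger time; exchanging \<open>s\<close> and
    \<open>t\<close> flips the sign of both numerator and denominator.\<close>
  have "(\<Sum>z\<in>UNIV. P (min s t) x z * ((P \<bar>s - t\<bar> z y - P 0 z y) / \<bar>s - t\<bar>))
      = (P s x y - P t x y) / (s - t)" if s: "0 \<le> s" "s \<noteq> t" for s
  proof -
    have "(\<Sum>z\<in>UNIV. P (min s t) x z * ((P \<bar>s - t\<bar> z y - P 0 z y) / \<bar>s - t\<bar>))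
        = (P (min s t + \<bar>s - t\<bar>) x y - P (min s t) x y) / \<bar>s - t\<bar>"
      using s t by (simp add: transition_semigroup_diff[OF P] sum_divide_distrib)
    also have "\<dots> = (P s x y - P t x y) / (s - t)"
    proof (cases "s < t")
      case True
      then show ?thesis by (simp add: min_def divide_simps algebra_simps)
    qed (use s in \<open>simp add: min_def\<close>)
    finally show ?thesis .
  qed
  then show "\<forall>\<^sub>F s in at t within {0..}.
      (\<Sum>z\<in>UNIV. P (min s t) x z * ((P \<bar>s - t\<bar> z y - P 0 z y) / \<bar>s - t\<bar>))
      = (P s x y - P t x y) / (s - t)"
    by (auto simp: eventually_at_filter)
qed

lemma bass_generator_sum:
  "(\<Sum>y\<in>UNIV. bass_generator p q z y * f y) =
     (\<Sum>j | \<not> z j. adoption_rate p q z j * (f (z(j := True)) - f z))"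
proof -
  \<comment> \<open>Each row is a combination of differences of point masses. This merges the two
    cases of the definition, because \<open>z(j := True)\<close> differs from \<open>z\<close> for
    every nonadopter \<open>j\<close>.\<close>
  have gen: "bass_generator p q z y =
      (\<Sum>j | \<not> z j. adoption_rate p q z j * (of_bool (y = z(j := True)) - of_bool (y = z)))" for y
  proof (cases "y = z")
    case True
    have "z \<noteq> z(j := True)" if "\<not> z j" for j
      using that by (metis fun_upd_same)
    then show ?thesis
      using True by (auto simp: bass_generator_def sum_negf[symmetric] intro!: sum.cong)
  next
    case False
    have "(\<Sum>j | \<not> z j \<and> y = z(j := True). adoption_rate p q z j)
        = (\<Sum>j | \<not> z j. adoption_rate p q z j * of_bool (y = z(j := True)))"
      by (rule sum.mono_neutral_cong_left) auto
    then show ?thesis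
      using False by (simp add: bass_generator_def)
  qed
  have "(\<Sum>y\<in>UNIV. bass_generator p q z y * f y) = (\<Sum>j | \<not> z j. \<Sum>y\<in>UNIV.
      adoption_rate p q z j * (of_bool (y = z(j := True)) * f y - of_bool (y = z) * f y))"
    by (subst sum.swap) (simp add: gen sum_distrib_right left_diff_distrib mult.assoc)
  also have "\<dots> = (\<Sum>j | \<not> z j. adoption_rate p q z j * (f (z(j := True)) - f z))"
    by (simp add: sum_distrib_left[symmetric] sum_subtractf of_bool_def if_distrib[of "\<lambda>b. b * _"]
        sum.delta cong: if_cong)
  finally show ?thesis .
qed

definition all_nonadopters :: "'n set \<Rightarrow> ('n \<Rightarrow> bool) \<Rightarrow> real" where
  "all_nonadopters A z = of_bool (\<forall>m\<in>A. \<not> z m)"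

text \<open>The identity holds state by state, so averaging it over the law at time \<open>t\<close>
  yields the differential equation.\<close>

lemma bass_generator_all_nonadopters:
  fixes A :: "'n::finite set"
  shows "(\<Sum>y\<in>UNIV. bass_generator p q z y * all_nonadopters A y) =
     - ((\<Sum>m\<in>A. p m) + (\<Sum>l\<in>UNIV - A. \<Sum>m\<in>A. q l m)) * all_nonadopters A z
     + (\<Sum>l\<in>UNIV - A. (\<Sum>m\<in>A. q l m) * all_nonadopters (insert l A) z)"
proof (cases "\<forall>m\<in>A. \<not> z m")
  case True
  have rate: "adoption_rate p q z m = p m + (\<Sum>l\<in>UNIV - A. q l m * of_bool (z l))" if "m \<in> A" for m
    unfolding adoption_rate_def using True that
    by (intro arg_cong2[of _ _ _ _ "(+)"] refl sum.mono_neutral_right) auto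
  have "(\<Sum>y\<in>UNIV. bass_generator p q z y * all_nonadopters A y) = (\<Sum>m\<in>A. - adoption_rate p q z m)"
    unfolding bass_generator_sum using True
    by (intro sum.mono_neutral_cong_right) (auto simp: all_nonadopters_def)
  also have "\<dots> = - (\<Sum>m\<in>A. p m) - (\<Sum>l\<in>UNIV - A. \<Sum>m\<in>A. q l m * of_bool (z l))"
    by (subst sum.swap) (simp only: rate sum_negf sum.distrib minus_add_distrib
        diff_conv_add_uminus cong: sum.cong)
  \<comment> \<open>With no adopters in \<open>A\<close>, the state of \<open>l\<close> is 1 minus
    the indicator of \<open>insert l A\<close>; this is where the larger sets enter.\<close>
  also have "(\<Sum>l\<in>UNIV - A. \<Sum>m\<in>A. q l m * of_bool (z l)) = (\<Sum>l\<in>UNIV - A. \<Sum>m\<in>A. q l m)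
      - (\<Sum>l\<in>UNIV - A. (\<Sum>m\<in>A. q l m) * all_nonadopters (insert l A) z)"
    unfolding sum_subtractf[symmetric] using True
    by (intro sum.cong) (auto simp: all_nonadopters_def)
  finally show ?thesis
    using True by (simp add: all_nonadopters_def)
next
  \<comment> \<open>An adopter in \<open>A\<close> remains one after any further adoption, so both
    sides vanish.\<close>
  case False
  then have "all_nonadopters A z = 0" "all_nonadopters (insert l A) z = 0"
    "all_nonadopters A (z(j := True)) = 0" for l j
    by (auto simp: all_nonadopters_def)
  then show ?thesis
    unfolding bass_generator_sum by simp
qed

lemma nonadopter_prob_0:
  assumes "bass_model \<Omega> p q X"
  shows "nonadopter_prob \<Omega> X A 0 = 1"
proof -
  interpret prob_space \<Omega>
    using assms by (simp add: bass_model_def ctmc_def)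
  have "(\<lambda>\<omega> j. X j 0 \<omega>) \<in> measurable \<Omega> (count_space UNIV)"
    using assms by (simp add: bass_model_def ctmc_def)
  then have "{\<omega> \<in> space \<Omega>. \<forall>m\<in>A. \<not> X m 0 \<omega>} \<in> events"
    using measurable_sets[of "\<lambda>\<omega> j. X j 0 \<omega>" \<Omega> "count_space UNIV" "{z. \<forall>m\<in>A. \<not> z m}"]
    by (simp add: vimage_def Int_def conj_commute)
  moreover have "AE \<omega> in \<Omega>. \<forall>m\<in>A. \<not> X m 0 \<omega>"
    using assms by (auto simp: bass_model_def)
  ultimately show ?thesis
    unfolding nonadopter_prob_def by (subst prob_eq_1) auto
qed

text \<open>The process starts almost surely without adopters, so its law at \<open>t\<close> is one
  row of \<open>P t\<close>. A single \<open>P\<close> serves all sets and times.\<close>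

lemma nonadopter_prob_eq_sum:
  assumes "bass_model \<Omega> p q X"
  obtains P where "transition_semigroup P" "has_generator P (bass_generator p q)"
    "\<And>A t. 0 \<le> t \<Longrightarrow>
      nonadopter_prob \<Omega> X A t = (\<Sum>y\<in>UNIV. P t (\<lambda>_. False) y * all_nonadopters A y)"
proof -
  interpret prob_space \<Omega>
    using assms by (simp add: bass_model_def ctmc_def)
  define Y where "Y t \<omega> = (\<lambda>j. X j t \<omega>)" for t \<omega>
  define x\<^sub>0 :: "'b \<Rightarrow> bool" where "x\<^sub>0 = (\<lambda>_. False)"
  have ctmc: "ctmc \<Omega> (bass_generator p q) Y"
    using assms by (simp add: bass_model_def Y_def[abs_def])
  then obtain P where P: "transition_semigroup P" "has_generator P (bass_generator p q)"
    and markov: "\<And>(n::nat) \<tau> x u y.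
           0 \<le> \<tau> 0 \<and> (\<forall>i<n. \<tau> i < \<tau> (Suc i)) \<and> \<tau> n \<le> u \<and>
           \<P>(\<omega> in \<Omega>. \<forall>i\<le>n. Y (\<tau> i) \<omega> = x i) > 0 \<Longrightarrow>
           \<P>(\<omega> in \<Omega>. Y u \<omega> = y \<bar> \<forall>i\<le>n. Y (\<tau> i) \<omega> = x i) = P (u - \<tau> n) (x n) y"
    unfolding ctmc_def by blast
  have meas: "Y t \<in> measurable \<Omega> (count_space UNIV)" if "0 \<le> t" for t
    using ctmc that by (simp add: ctmc_def)
  have start: "AE \<omega> in \<Omega>. Y 0 \<omega> = x\<^sub>0"
    using assms by (auto simp: bass_model_def Y_def x\<^sub>0_def fun_eq_iff)
  have start1: "\<P>(\<omega> in \<Omega>. Y 0 \<omega> = x\<^sub>0) = 1"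
    using nonadopter_prob_0[OF assms, of UNIV]
    by (simp add: nonadopter_prob_def Y_def x\<^sub>0_def fun_eq_iff)
  have law: "\<P>(\<omega> in \<Omega>. Y t \<omega> = y) = P t x\<^sub>0 y" if t: "0 \<le> t" for t y
  proof -
    note [measurable] = meas[OF t] meas[OF order_refl]
    have "\<P>(\<omega> in \<Omega>. Y t \<omega> = y) = \<P>(\<omega> in \<Omega>. Y t \<omega> = y \<and> Y 0 \<omega> = x\<^sub>0)"
      using start by (intro measure_eq_AE) auto
    also have "\<dots> = \<P>(\<omega> in \<Omega>. Y t \<omega> = y \<bar> Y 0 \<omega> = x\<^sub>0)"
      by (simp add: cond_prob_def start1)
    also have "\<dots> = P t x\<^sub>0 y"
      \<comment> \<open>The Markov property with 0 as the only observation time;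
        \<open>start1\<close> makes the conditioning event have positive probability.\<close>
      using markov[of "\<lambda>_. 0" 0 t "\<lambda>_. x\<^sub>0" y] t start1 by simp
    finally show ?thesis .
  qed
  have "nonadopter_prob \<Omega> X A t = (\<Sum>y\<in>UNIV. P t x\<^sub>0 y * all_nonadopters A y)"
    if t: "0 \<le> t" for A t
  proof -
    note [measurable] = meas[OF t]
    let ?Z = "{z. \<forall>m\<in>A. \<not> z m}"
    \<comment> \<open>The event splits into finitely many disjoint events, one for each
      configuration in \<open>?Z\<close>.\<close>
    have "nonadopter_prob \<Omega> X A t = prob (\<Union>y\<in>?Z. {\<omega> \<in> space \<Omega>. Y t \<omega> = y})"
      unfolding nonadopter_prob_def by (rule arg_cong[of _ _ prob]) (auto simp: Y_def)
    also have "\<dots> = (\<Sum>y\<in>?Z. \<P>(\<omega> in \<Omega>. Y t \<omega> = y))"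
      by (rule finite_measure_finite_Union) (auto simp: disjoint_family_on_def)
    also have "\<dots> = (\<Sum>y\<in>UNIV. P t x\<^sub>0 y * all_nonadopters A y)"
      by (rule sum.mono_neutral_cong_left) (auto simp: law[OF t] all_nonadopters_def)
    finally show ?thesis .
  qed
  then show thesis
    using that[OF P] by (simp add: x\<^sub>0_def)
qed

lemma nonadopter_prob_has_derivative:
  assumes "bass_model \<Omega> p q X" and t: "0 \<le> t"
  shows "(nonadopter_prob \<Omega> X A has_real_derivative
     - ((\<Sum>m\<in>A. p m) + (\<Sum>l\<in>UNIV - A. \<Sum>m\<in>A. q l m)) * nonadopter_prob \<Omega> X A t
     + (\<Sum>l\<in>UNIV - A. (\<Sum>m\<in>A. q l m) * nonadopter_prob \<Omega> X (insert l A) t)) (at t within {0..})"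
    (is "(_ has_real_derivative ?D) _")
proof -
  obtain P where P: "transition_semigroup P" "has_generator P (bass_generator p q)"
    and prob_eq: "\<And>A t. 0 \<le> t \<Longrightarrow>
      nonadopter_prob \<Omega> X A t = (\<Sum>y\<in>UNIV. P t (\<lambda>_. False) y * all_nonadopters A y)"
    using nonadopter_prob_eq_sum[OF assms(1)] by blast
  let ?P = "\<lambda>s. P s (\<lambda>_. False)"
  have "((\<lambda>s. \<Sum>y\<in>UNIV. ?P s y * all_nonadopters A y) has_real_derivative
      (\<Sum>y\<in>UNIV. (\<Sum>z\<in>UNIV. ?P t z * bass_generator p q z y) * all_nonadopters A y))
      (at t within {0..})"
    by (intro DERIV_sum DERIV_cmult_right kolmogorov_forward[OF P t])
  \<comment> \<open>Associativity of the matrix products: the generator moves from the law onto the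
    indicator.\<close>
  also have "(\<Sum>y\<in>UNIV. (\<Sum>z\<in>UNIV. ?P t z * bass_generator p q z y) * all_nonadopters A y)
      = (\<Sum>z\<in>UNIV. ?P t z * (\<Sum>y\<in>UNIV. bass_generator p q z y * all_nonadopters A y))"
    unfolding sum_distrib_left sum_distrib_right mult.assoc by (rule sum.swap)
  also have "\<dots> = - ((\<Sum>m\<in>A. p m) + (\<Sum>l\<in>UNIV - A. \<Sum>m\<in>A. q l m)) *
        (\<Sum>z\<in>UNIV. ?P t z * all_nonadopters A z)
      + (\<Sum>z\<in>UNIV. \<Sum>l\<in>UNIV - A. (\<Sum>m\<in>A. q l m) * (?P t z * all_nonadopters (insert l A) z))"
    by (simp only: bass_generator_all_nonadopters distrib_left sum.distrib sum_distrib_left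
        mult.left_commute)
  also have "\<dots> = ?D"
    by (subst sum.swap) (simp only: prob_eq[OF t] sum_distrib_left)
  finally show ?thesis
    \<comment> \<open>\<open>prob_eq\<close> covers all nonnegative times, so any positive radius
      would do.\<close>
    by (rule has_field_derivative_transform_within[where d = 1]) (use t in \<open>auto simp: prob_eq\<close>)
qed

theorem lemma2:
  fixes \<Omega> :: "'w measure"
    and p :: "'n::finite \<Rightarrow> real"
    and q :: "'n \<Rightarrow> 'n \<Rightarrow> real"
    and X :: "'n \<Rightarrow> real \<Rightarrow> 'w \<Rightarrow> bool"
  assumes "bass_model \<Omega> p q X"
  shows "(\<forall>A t. A \<noteq> {} \<and> A \<subset> UNIV \<and> 0 \<le> t \<longrightarrow>
            (nonadopter_prob \<Omega> X A has_real_derivative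
               - ((\<Sum>m\<in>A. p m) + (\<Sum>l\<in>UNIV - A. \<Sum>m\<in>A. q l m)) * nonadopter_prob \<Omega> X A t
               + (\<Sum>l\<in>UNIV - A. (\<Sum>m\<in>A. q l m) * nonadopter_prob \<Omega> X (insert l A) t))
              (at t within {0..})) \<and>
         (\<forall>t\<ge>0. (nonadopter_prob \<Omega> X UNIV has_real_derivative
               - (\<Sum>m\<in>UNIV. p m) * nonadopter_prob \<Omega> X UNIV t) (at t within {0..})) \<and>
         (\<forall>A. A \<noteq> {} \<longrightarrow> nonadopter_prob \<Omega> X A 0 = 1)"
proof -
  note deriv = nonadopter_prob_has_derivative[OF assms]
  show ?thesis
    \<comment> \<open>For \<open>A = UNIV\<close> the sums over \<open>UNIV - A\<close> are empty,
      which leaves the second equation.\<close>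
    using deriv deriv[where A = UNIV] nonadopter_prob_0[OF assms] by auto
qed

end
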